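(* No group generated by a $3$-state invertible automaton over a $2$-letter alphabet is an infinite torsion group.
   Context: Let $X=\{0,1\}$ and let $X^*$ be the set of finite words over $X$, viewed as the rooted binary tree. Let $\sigma$ be the transposition $(01)$ of $X$. An invertible automaton $A$ with $3$ states over $X$ is given by a system of three relations $q=\sigma^{i_q}(q_0,q_1)$, one for each state $q$, where $i_q\in\{0,1\}$ and $q_0,q_1$ are states. Each state $q$ defines an automorphism of the tree $X^*$, recursively by $q(\emptyset)=\emptyset$ and $q(xw)=\sigma^{i_q}(x)\,q_x(w)$ for $x\in X$, $w\in X^*$. The group generated by $A$ is the subgroup $G(A)$ of $\mathrm{Aut}(X^* )$ generated by the three states. A torsion group is a group in which every element has finite order. *)

theory Defs
  imports "HOL-Algebra.Generated_Groups" "HOL-Library.Z2" "HOL-Library.Cardinality" "HOL-Combinatorics.Transposition"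
begin

text \<open>The alphabet \<open>X = {0, 1}\<close> is the type \<open>bit\<close>, whose only elements are \<open>0\<close> and \<open>1\<close>.\<close>

type_synonym word = "bit list"

definition tree_adjacent :: "word \<Rightarrow> word \<Rightarrow> bool" where
  "tree_adjacent u v \<longleftrightarrow> (\<exists>x. v = u @ [x] \<or> u = v @ [x])"

definition tree_automorphism :: "(word \<Rightarrow> word) \<Rightarrow> bool" where
  "tree_automorphism f \<longleftrightarrow>
     bij f \<and> f [] = [] \<and> (\<forall>u v. tree_adjacent (f u) (f v) \<longleftrightarrow> tree_adjacent u v)"

definition Aut_tree :: "(word \<Rightarrow> word) monoid" where
  "Aut_tree = \<lparr>carrier = {f. tree_automorphism f}, mult = (\<circ>), one = id\<rparr>"

definition sigma :: "bit \<Rightarrow> bit" where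
  "sigma = transpose 0 1"

text \<open>
  A state \<open>q\<close> of an automaton \<open>A\<close> has the relation
  \<open>q = sigma ^^ expo A q (succ A q 0, succ A q 1)\<close>.
\<close>

record 'q automaton =
  expo :: "'q \<Rightarrow> nat"
  succ :: "'q \<Rightarrow> bit \<Rightarrow> 'q"

definition invertible_automaton :: "'q automaton \<Rightarrow> bool" where
  "invertible_automaton A \<longleftrightarrow> (\<forall>q. expo A q \<in> {0, 1})"

primrec state_map :: "'q automaton \<Rightarrow> 'q \<Rightarrow> word \<Rightarrow> word" where
  "state_map A q [] = []"
| "state_map A q (x # w) = (sigma ^^ expo A q) x # state_map A (succ A q x) w"

definition automaton_group :: "'q automaton \<Rightarrow> (word \<Rightarrow> word) monoid" where
  "automaton_group A = subgroup_generated Aut_tree (range (state_map A))"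

definition torsion_group :: "('a, 'b) monoid_scheme \<Rightarrow> bool" where
  "torsion_group G \<longleftrightarrow>
     group G \<and> (\<forall>g\<in>carrier G. \<exists>n::nat. n > 0 \<and> g [^]\<^bsub>G\<^esub> n = \<one>\<^bsub>G\<^esub>)"

text \<open>
  \<^const>\<open>subgroup_generated\<close> intersects its generators with the carrier, so the
  following facts are needed for \<^const>\<open>automaton_group\<close> to be the intended group.
\<close>

lemma group_Aut_tree: "group Aut_tree"
proof (rule groupI)
  fix f assume "f \<in> carrier Aut_tree"
  then have b: "bij f" and r: "f [] = []"
    and a: "\<And>u v. tree_adjacent (f u) (f v) \<longleftrightarrow> tree_adjacent u v"
    by (auto simp: Aut_tree_def tree_automorphism_def)
  have f_inv: "f (inv_into UNIV f u) = u" for u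
    using b by (simp add: bij_is_surj surj_f_inv_f)
  have "tree_automorphism (inv_into UNIV f)"
    unfolding tree_automorphism_def
    using b r a f_inv by (metis bij_imp_bij_inv bij_inv_eq_iff)
  moreover have "inv_into UNIV f \<circ> f = id"
    using b by (simp add: bij_is_inj)
  ultimately show "\<exists>g\<in>carrier Aut_tree. g \<otimes>\<^bsub>Aut_tree\<^esub> f = \<one>\<^bsub>Aut_tree\<^esub>"
    by (auto simp: Aut_tree_def)
qed (auto simp: Aut_tree_def tree_automorphism_def o_assoc intro: bij_comp)

lemma sigma_pow_involution: "(sigma ^^ n) ((sigma ^^ n) x) = x"
proof (induction n)
  case (Suc n)
  have "sigma (sigma y) = y" for y by (simp add: sigma_def)
  with Suc show ?case by (metis comp_apply funpow.simps(2) funpow_swap1)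
qed simp

lemma length_state_map [simp]: "length (state_map A q w) = length w"
  by (induction w arbitrary: q) auto

lemma inj_state_map: "state_map A q u = state_map A q v \<Longrightarrow> u = v"
proof (induction u arbitrary: q v)
  case Nil
  then show ?case by (metis length_state_map length_0_conv)
next
  case (Cons x u)
  then obtain y w where v: "v = y # w"
    by (metis length_state_map length_Suc_conv)
  with Cons.prems have "x = y" by (metis list.inject state_map.simps(2) sigma_pow_involution)
  with v Cons show ?case by auto
qed

lemma surj_state_map: "\<exists>u. state_map A q u = w"
proof (induction w arbitrary: q)
  case Nil
  show ?case by (rule exI[of _ "[]"]) simp
next
  case (Cons y w)
  obtain u where "state_map A (succ A q ((sigma ^^ expo A q) y)) u = w"
    using Cons by blast
  then have "state_map A q ((sigma ^^ expo A q) y # u) = y # w"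
    by (simp add: sigma_pow_involution)
  then show ?case by blast
qed

lemma state_map_snoc: "\<exists>y. state_map A q (u @ [x]) = state_map A q u @ [y]"
  by (induction u arbitrary: q) auto

lemma state_map_extend_iff:
  "(\<exists>x. state_map A q v = state_map A q u @ [x]) \<longleftrightarrow> (\<exists>x. v = u @ [x])"
proof
  assume "\<exists>x. state_map A q v = state_map A q u @ [x]"
  then obtain x where x: "state_map A q v = state_map A q u @ [x]" by blast
  then have "length v = Suc (length u)"
    by (metis length_append_singleton length_state_map)
  then obtain w y where v: "v = w @ [y]"
    by (metis length_Suc_conv_rev)
  with x state_map_snoc[of A q w y] have "state_map A q w = state_map A q u" by auto
  with v show "\<exists>x. v = u @ [x]" by (auto dest: inj_state_map)
qed (use state_map_snoc in auto)

lemma state_map_in_Aut_tree: "state_map A q \<in> carrier Aut_tree"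
proof -
  have "bij (state_map A q)"
    by (intro bijI injI) (auto dest: inj_state_map intro: surjI simp: surj_def,
        metis surj_state_map)
  then show ?thesis
    unfolding Aut_tree_def tree_automorphism_def tree_adjacent_def
    using state_map_extend_iff[of A q] by (simp add: ex_disj_distrib)
qed

end

theory Submission
  imports Defs
begin

text \<open>Infinite order is never argued from a least order. Each test takes an arbitrary exponent
  \<open>n > 0\<close> of the word and derives either a smaller exponent of the same kind or a
  finite word that the \<open>n\<close>-th power moves. The count 1458 is 2 * 9^3: sorting the
  states by activity leaves two nonconstant activity patterns, and each of the three states has nine
  possible pairs of sections. The numerical bounds in the tests limit the computation only. A bound
  that is too small can make a test fail, but cannot make it succeed wrongly. For finiteness it is
  enough to bound the monoid of words without inverse letters, because a finite monoid of injective
  maps contains the inverses of its elements.\<close>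

text \<open>
  An automaton whose states are all active or all inactive generates a group of order at most 2. Up to
  renaming the states there remain 1458 tables, and for each of them a computation in the simplifier
  certifies that the group is finite or exhibits an element of infinite order. Such an element is
  recognized in one of three ways: it acts transitively on every level; its order, if finite, would be a
  proper divisor of itself, because a section of its square leads back to a conjugate of it or of its
  inverse; or the orbit of a periodic sequence never returns, since the last place where the sequence
  differs from its period only moves to the right.
\<close>

section \<open>Words of states acting on the tree\<close>

datatype st = S0 | S1 | S2

text \<open>
  A table lists the activities of the three states and, for each of them, its two sections. The letter
  \<open>(s, True)\<close> stands for the inverse of the state \<open>s\<close>, and the first letter of a word acts first.
\<close>

type_synonym letter = "st \<times> bool"
type_synonym table = "(bool \<times> bool \<times> bool) \<times> (st \<times> st) \<times> (st \<times> st) \<times> (st \<times> st)"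

fun act :: "table \<Rightarrow> st \<Rightarrow> bool" where
  "act ((i, j, k), r) S0 = i"
| "act ((i, j, k), r) S1 = j"
| "act ((i, j, k), r) S2 = k"

fun row :: "table \<Rightarrow> st \<Rightarrow> st \<times> st" where
  "row (i, r0, r1, r2) S0 = r0"
| "row (i, r0, r1, r2) S1 = r1"
| "row (i, r0, r1, r2) S2 = r2"

definition nxt :: "table \<Rightarrow> st \<Rightarrow> bool \<Rightarrow> st" where
  "nxt T s x = (if x then snd (row T s) else fst (row T s))"

text \<open>The section of the inverse of \<open>s\<close> at \<open>x\<close> is the inverse of the
  section of \<open>s\<close> at the preimage of \<open>x\<close>, and this preimage is
  \<open>x\<close> flipped exactly when \<open>s\<close> is active.\<close>

fun lnxt :: "table \<Rightarrow> letter \<Rightarrow> bool \<Rightarrow> letter" where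
  "lnxt T (s, i) x = (nxt T s (if i then x \<noteq> act T s else x), i)"

fun step :: "table \<Rightarrow> letter list \<Rightarrow> bool \<Rightarrow> letter list \<times> bool" where
  "step T [] x = ([], x)"
| "step T (l # w) x =
     (case step T w (x \<noteq> act T (fst l)) of (v, y) \<Rightarrow> (lnxt T l x # v, y))"

fun run :: "table \<Rightarrow> letter list \<Rightarrow> bool list \<Rightarrow> letter list \<times> bool list" where
  "run T w [] = (w, [])"
| "run T w (x # u) =
     (case step T w x of (v, y) \<Rightarrow> case run T v u of (v', u') \<Rightarrow> (v', y # u'))"

fun ev :: "table \<Rightarrow> letter list \<Rightarrow> bool list \<Rightarrow> bool list" where
  "ev T w [] = []"
| "ev T w (x # u) = snd (step T w x) # ev T (fst (step T w x)) u"

lemma run_eq: "snd (run T w u) = ev T w u"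
  by (induction T w u rule: run.induct) (auto split: prod.splits)

lemma ev_append_word:
  "ev T w (u @ v) = ev T w u @ ev T (fst (run T w u)) v"
  by (induction u arbitrary: w) (auto split: prod.splits)

lemma run_append:
  "run T w (u @ v) = (fst (run T (fst (run T w u)) v), ev T w (u @ v))"
proof (induction u arbitrary: w)
  case Nil
  show ?case by (auto simp: prod_eq_iff run_eq)
qed (auto split: prod.splits)

lemma length_ev [simp]: "length (ev T w u) = length u"
  by (induction u arbitrary: w) auto

lemma step_append:
  "step T (w @ v) x = (fst (step T w x) @ fst (step T v (snd (step T w x))), snd (step T v (snd (step T w x))))"
  by (induction w arbitrary: x) (auto split: prod.splits)

lemma ev_Nil [simp]: "ev T [] u = u"
  by (induction u) auto

lemma ev_append: "ev T (w @ v) u = ev T v (ev T w u)"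
  by (induction u arbitrary: w v) (auto simp: step_append)

lemma ev_Nil_id: "ev T [] = id"
  by (simp add: fun_eq_iff)

fun inv_letter :: "letter \<Rightarrow> letter" where
  "inv_letter (s, i) = (s, \<not> i)"

definition inv_word :: "letter list \<Rightarrow> letter list" where
  "inv_word w = rev (map inv_letter w)"

lemma inv_letter_involutive [simp]: "inv_letter (inv_letter l) = l"
  by (cases l) auto

lemma inv_word_simps [simp]:
  "inv_word [] = []" "inv_word (l # w) = inv_word w @ [inv_letter l]"
  "inv_word (w @ v) = inv_word v @ inv_word w"
  by (auto simp: inv_word_def)

lemma inv_word_involutive [simp]: "inv_word (inv_word w) = w"
  by (induction w) auto

lemma step_inv_letter: "step T [l, inv_letter l] x = ([lnxt T l x, inv_letter (lnxt T l x)], x)"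
  by (cases l; cases x; cases "act T (fst l)") auto

lemma ev_inv_letter: "ev T [l, inv_letter l] u = u"
  by (induction u arbitrary: l) (auto simp: step_inv_letter simp del: step.simps)

lemma ev_cancel: "ev T (l # inv_letter l # w) = ev T w"
proof
  fix u show "ev T (l # inv_letter l # w) u = ev T w u"
    using ev_append[of T "[l, inv_letter l]" w u] by (simp add: ev_inv_letter)
qed

lemma ev_inv_word: "ev T (inv_word w) (ev T w u) = u" 
proof (induction w arbitrary: u)
  case (Cons l w)
  have "ev T (inv_word (l # w)) (ev T (l # w) u) = ev T [inv_letter l] (ev T (inv_word w) (ev T w (ev T [l] u)))"
    using ev_append[of T "[l]" w u] ev_append[of T "inv_word w" "[inv_letter l]"] by simp
  also have "\<dots> = u"
    using Cons ev_inv_letter[of T l u] ev_append[of T "[l]" "[inv_letter l]" u] by simp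
  finally show ?case .
qed simp

lemma ev_Cons: "ev T (l # w) = ev T w \<circ> ev T [l]"
  using ev_append[of T "[l]" w] by auto

lemma ev_Cons_cong:
  assumes "ev T v = ev T w" shows "ev T (l # v) = ev T (l # w)"
proof -
  have "ev T (l # v) = ev T v \<circ> ev T [l]" by (rule ev_Cons)
  also have "\<dots> = ev T w \<circ> ev T [l]" using assms by simp
  also have "\<dots> = ev T (l # w)" by (rule ev_Cons[symmetric])
  finally show ?thesis .
qed

fun free_reduce :: "letter list \<Rightarrow> letter list" where
  "free_reduce [] = []"
| "free_reduce (l # w) = (case free_reduce w of [] \<Rightarrow> [l]
     | l' # v \<Rightarrow> if l' = inv_letter l then v else l # l' # v)"

fun cyclic_reduce :: "nat \<Rightarrow> letter list \<Rightarrow> letter list" where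
  "cyclic_reduce 0 w = w"
| "cyclic_reduce (Suc n) w = (if w \<noteq> [] \<and> hd w = inv_letter (last w)
     then cyclic_reduce n (butlast (tl w)) else w)"

text \<open>Sections of squares grow in length, so a return can be recognized only after
  cancellation. Passing to a conjugate is harmless for exponents. The 8 bounds the rounds of
  conjugation; stopping early merely leaves a longer conjugate.\<close>

definition reduce :: "letter list \<Rightarrow> letter list" where
  "reduce w = cyclic_reduce 8 (free_reduce w)"

lemma ev_free_reduce: "ev T (free_reduce w) = ev T w"
proof (induction w)
  case IH: (Cons l w)
  show ?case
  proof (cases "free_reduce w")
    case Nil
    then show ?thesis using ev_Cons_cong[OF IH, of l] by simp
  next
    case (Cons l' v)
    have "ev T (l # l' # v) = ev T (l # w)" using ev_Cons_cong[OF IH, of l] Cons by simp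
    then show ?thesis
      using Cons ev_cancel[of T l v] by (cases "l' = inv_letter l") simp_all
  qed
qed simp

section \<open>Exponents of elements and their sections\<close>

definition exponent :: "table \<Rightarrow> letter list \<Rightarrow> nat \<Rightarrow> bool" where
  "exponent T w n \<longleftrightarrow> n > 0 \<and> (ev T w ^^ n) = id"

lemma exponent_free_reduce: "exponent T (free_reduce w) n \<longleftrightarrow> exponent T w n"
  by (simp add: exponent_def ev_free_reduce)

lemma exponent_rotate:
  assumes "exponent T (u @ v) n" shows "exponent T (v @ u) n"
proof -
  have uv: "ev T (u @ v) = ev T v \<circ> ev T u" "ev T (v @ u) = ev T u \<circ> ev T v"
    by (auto simp: ev_append)
  have "(ev T u \<circ> (ev T v \<circ> ev T u) ^^ m) = ((ev T u \<circ> ev T v) ^^ m \<circ> ev T u)" for m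
    by (induction m) (auto simp: fun_eq_iff)
  from this[of n] have "ev T u = (ev T u \<circ> ev T v) ^^ n \<circ> ev T u"
    using assms by (simp add: exponent_def uv)
  then have "((ev T u \<circ> ev T v) ^^ n) x = x" for x
    using ev_inv_word[of T "inv_word u" x] by (metis comp_apply inv_word_involutive)
  then show ?thesis using assms by (auto simp: exponent_def uv)
qed

lemma exponent_inv_word:
  assumes "exponent T w n" shows "exponent T (inv_word w) n"
proof -
  have "(ev T (inv_word w) ^^ m) ((ev T w ^^ m) u) = u" for m u
    by (induction m arbitrary: u) (auto simp: ev_inv_word funpow_swap1)
  from this[of n] have "(ev T (inv_word w) ^^ n) u = u" for u
    using assms by (simp add: exponent_def)
  then show ?thesis using assms by (auto simp: exponent_def)
qed

lemma exponent_cyclic_reduce: "exponent T w n \<Longrightarrow> exponent T (cyclic_reduce m w) n"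
proof (induction m w rule: cyclic_reduce.induct)
  case (2 m w)
  show ?case
  proof (cases "w \<noteq> [] \<and> hd w = inv_letter (last w)")
    case True
    then obtain l v where w: "w = l # v" by (cases w) auto
    \<comment> \<open>A letter is never its own inverse, so the first and the last letter occupy
      different positions.\<close>
    with True have "v \<noteq> []" by (cases l) auto
    then obtain v' l' where v: "v = v' @ [l']" by (metis append_butlast_last_id)
    have l: "l = inv_letter l'" using True w v by simp
    have "exponent T ([l', inv_letter l'] @ v') n"
      using exponent_rotate[of T "l # v'" "[l']"] 2(2) w v l by simp
    then have "exponent T v' n" by (simp add: exponent_def ev_cancel)
    then show ?thesis using 2(1) True w v by simp
  qed (use 2 in auto)
qed simp

lemma exponent_reduce: "exponent T w n \<Longrightarrow> exponent T (reduce w) n"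
  by (simp add: reduce_def exponent_cyclic_reduce exponent_free_reduce)

lemma exponent_section:
  assumes "exponent T w n" and "snd (step T w x) = x"
  shows "exponent T (fst (step T w x)) n"
proof -
  have "(ev T w ^^ m) (x # u) = x # (ev T (fst (step T w x)) ^^ m) u" for m u
    by (induction m) (auto simp: assms)
  from this[of n] show ?thesis using assms by (auto simp: exponent_def)
qed

text \<open>A word that moves one letter swaps both, so only its even powers can be trivial. Its
  square fixes \<open>x\<close>, and the section there inherits half of the exponent.\<close>

lemma exponent_square:
  assumes "exponent T w n" and "snd (step T w x) \<noteq> x"
  shows "\<exists>m<n. exponent T (fst (step T (w @ w) x)) m"
proof -
  have flip: "snd (step T w y) = (\<not> y)" for y
  proof -
    have "snd (step T w (\<not> x)) \<noteq> snd (step T w x)"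
    proof
      assume "snd (step T w (\<not> x)) = snd (step T w x)"
      then have "ev T w [\<not> x] = ev T w [x]" by simp
      then show False using ev_inv_word[of T w] by (metis list.inject)
    qed
    with assms(2) show ?thesis by (cases x; cases y) auto
  qed
  have pow: "\<exists>v. (ev T w ^^ m) (x # u) = (if even m then x else \<not> x) # v" for m u
    by (induction m) (auto simp: flip)
  have "even n"
    using pow[of n "[]"] assms(1) by (auto simp: exponent_def split: if_splits)
  then obtain m where m: "n = m + m" by (metis evenE mult_2)
  have "ev T w \<circ> ev T w = ev T (w @ w)" by (auto simp: ev_append)
  then have "ev T (w @ w) ^^ m = ev T w ^^ n"
    by (metis funpow_mult m mult_2 numeral_2_eq_2 funpow.simps(1,2) comp_id)
  then have "exponent T (w @ w) m" using assms(1) m by (auto simp: exponent_def)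
  moreover have "snd (step T (w @ w) x) = x" by (auto simp: step_append flip)
  ultimately have "exponent T (fst (step T (w @ w) x)) m" by (rule exponent_section)
  moreover have "m < n" using assms(1) m by (simp add: exponent_def)
  ultimately show ?thesis by blast
qed

section \<open>Elements of infinite order from returning sections\<close>

text \<open>
  Below a vertex on an orbit of length 1 or 2 of \<open>w\<close>, the word acts as its section or as a section of its
  square, and in the second case the order is halved.
\<close>

fun descend :: "table \<Rightarrow> letter list \<times> bool \<Rightarrow> bool list \<Rightarrow> letter list \<times> bool" where
  "descend T (w, h) [] = (w, h)"
| "descend T (w, h) (x # path) = (case step T w x of (v, y) \<Rightarrow>
     if y = x then descend T (reduce v, h) path
     else descend T (reduce (v @ fst (step T w y)), True) path)"

definition rotations :: "letter list \<Rightarrow> letter list list" where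
  "rotations w = map (\<lambda>n. rotate n w) [0..<length w]"

text \<open>
  If the descent returns to a conjugate of \<open>w\<close> or of its inverse after at least one halving, then a finite
  order of \<open>w\<close> would be a proper divisor of itself.
\<close>

fun returns :: "table \<Rightarrow> letter list \<times> bool list \<Rightarrow> bool" where
  "returns T (w, path) = (case descend T (w, False) path of (v, h) \<Rightarrow>
     h \<and> length v = length w \<and> (v \<in> set (rotations w) \<or> inv_word v \<in> set (rotations w)))"

lemma exponent_descend:
  assumes "exponent T w n"
  shows "\<exists>m\<le>n. exponent T (fst (descend T (w, h) path)) m \<and> (\<not> h \<and> snd (descend T (w, h) path) \<longrightarrow> m < n)"
  using assms
proof (induction path arbitrary: w h n)
  case (Cons x path)
  obtain v y where vy: "step T w x = (v, y)" by fastforce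
  show ?case
  proof (cases "y = x")
    case True
    have "exponent T (reduce v) n"
      using exponent_section[of T w n x] Cons.prems vy True by (simp add: exponent_reduce)
    from Cons.IH[OF this, of h] show ?thesis using vy True by auto
  next
    case False
    then obtain m where m: "m < n" "exponent T (reduce (fst (step T (w @ w) x))) m"
      using exponent_square[of T w n x] Cons.prems vy by (auto intro: exponent_reduce)
    have "fst (step T (w @ w) x) = v @ fst (step T w y)" using vy by (simp add: step_append)
    with Cons.IH[OF m(2), of True] vy False
    obtain k where "k \<le> m" "exponent T (fst (descend T (w, h) (x # path))) k" by auto
    \<comment> \<open>After a halving the induction hypothesis is used with the flag already set and
      gives only \<open>k \<le> m\<close>; strictness comes from \<open>m < n\<close>.\<close>
    with m(1) show ?thesis by (intro exI[of _ k]) auto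
  qed
qed auto

lemma exponent_rotations: "exponent T v n \<Longrightarrow> v \<in> set (rotations w) \<Longrightarrow> exponent T w n"
proof -
  assume v: "exponent T v n" and "v \<in> set (rotations w)"
  then obtain i where i: "v = rotate i w" by (auto simp: rotations_def)
  show ?thesis
    using v exponent_rotate[of T "drop (i mod length w) w" "take (i mod length w) w" n]
    by (simp add: i rotate_drop_take)
qed

lemma not_exponent_returns:
  assumes "returns T (w, path)"
  shows "\<not> exponent T w n"
proof (induction n rule: less_induct)
  case (less n)
  show ?case
  proof
    assume e: "exponent T w n"
    obtain v h where vh: "descend T (w, False) path = (v, h)" by fastforce
    with exponent_descend[OF e, of False path] assms obtain m where m: "m < n" "exponent T v m"
      by auto
    then have "exponent T w m"
      using assms vh exponent_rotations[of T _ m w] exponent_inv_word[of T v m] by auto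
    with less m show False by blast
  qed
qed

section \<open>Closing a set under successors\<close>

text \<open>
  A depth-first search which succeeds only if every element reachable from the list \<open>todo\<close> satisfies \<open>ok\<close>;
  the number bounds its length.
\<close>

fun explore :: "('a \<Rightarrow> bool) \<Rightarrow> ('a \<Rightarrow> 'a list) \<Rightarrow> nat \<Rightarrow> 'a list \<Rightarrow> 'a list \<Rightarrow> bool" where
  "explore ok succs n [] seen = True"
| "explore ok succs 0 (h # todo) seen = False"
| "explore ok succs (Suc n) (h # todo) seen =
     (if h \<in> set seen then explore ok succs n todo seen
      else if ok h then explore ok succs n (succs h @ todo) (h # seen) else False)"

lemma explore_closed:
  assumes "explore ok succs n todo seen"
    and "\<And>h. h \<in> set seen \<Longrightarrow> ok h \<and> set (succs h) \<subseteq> set seen \<union> set todo"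
  shows "\<exists>S. set todo \<union> set seen \<subseteq> S \<and> (\<forall>h\<in>S. ok h \<and> set (succs h) \<subseteq> S)"
  using assms
proof (induction ok succs n todo seen rule: explore.induct)
  case (1 ok succs n seen)
  then show ?case by (intro exI[of _ "set seen"]) auto
next
  case (3 ok succs n h todo seen)
  show ?case
  proof (cases "h \<in> set seen")
    case True
    with 3(1)[OF True] 3(3) 3(4) show ?thesis by (simp add: insert_absorb)
  next
    case False
    with 3(3) have ok: "ok h" by (auto split: if_splits)
    have "\<exists>S. set (succs h @ todo) \<union> set (h # seen) \<subseteq> S \<and> (\<forall>h\<in>S. ok h \<and> set (succs h) \<subseteq> S)"
      using 3(2)[OF False ok] 3(3,4) False ok by fastforce
    then show ?thesis by auto
  qed
qed auto

lemma explore_invariant: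
  assumes "explore ok succs n [h] []"
  shows "\<exists>S. h \<in> S \<and> (\<forall>h\<in>S. ok h \<and> set (succs h) \<subseteq> S)"
proof -
  from explore_closed[OF assms] obtain S
    where "set [h] \<union> set [] \<subseteq> S \<and> (\<forall>h\<in>S. ok h \<and> set (succs h) \<subseteq> S)" by auto
  then show ?thesis by (intro exI[of _ S]) simp
qed

section \<open>Elements of infinite order from ratchets\<close>

text \<open>
  In blocks of \<open>length p\<close> letters: the element moves \<open>p p p \<dots>\<close> to a sequence whose last block
  different from \<open>p\<close> is \<open>q\<close>, and its sections at the ends of blocks preserve the sequences with this
  property. Hence no positive power of the element fixes \<open>p p p \<dots>\<close>. The number \<open>k\<close> bounds how many
  blocks are read until the section reached fixes \<open>p p p \<dots>\<close>.
\<close>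

definition blocks :: "nat \<Rightarrow> bool list list" where
  "blocks d = List.n_lists d [False, True]"

fun last_block :: "table \<Rightarrow> bool list \<Rightarrow> nat \<Rightarrow> letter list \<times> bool list \<Rightarrow> letter list \<times> bool list" where
  "last_block T p 0 (h, c) = (h, c)"
| "last_block T p (Suc k) (h, c) =
     (case run T h p of (h', y) \<Rightarrow> last_block T p k (h', if y = p then c else y))"

text \<open>The image of \<open>b\<close> is the initial candidate for the last block, even when it
  equals \<open>p\<close>; in that case \<open>c = q\<close> fails because \<open>ratchet\<close>
  demands \<open>q \<noteq> p\<close>. After the \<open>k\<close> blocks the section fixes all
  further copies of \<open>p\<close>, so the candidate is final.\<close>

definition pushes :: "table \<Rightarrow> bool list \<Rightarrow> bool list \<Rightarrow> nat \<Rightarrow> bool list \<Rightarrow> letter list \<Rightarrow> bool" where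
  "pushes T p q k b h = (case last_block T p k (run T h b) of (h', c) \<Rightarrow>
     c = q \<and> run T h' p = (h', p))"

text \<open>What precedes the last block \<open>q\<close> is arbitrary, so the section acting from
  there on can be any one reached from \<open>w\<close> by reading blocks; hence the exploration.
  The first application, to copies of \<open>p\<close> alone, is tested separately.\<close>

fun ratchet :: "table \<Rightarrow> letter list \<times> bool list \<times> bool list \<times> nat \<Rightarrow> bool" where
  "ratchet T (w, p, q, k) =
     (q \<noteq> p \<and> length q = length p \<and> pushes T p q k p w \<and>
      explore (pushes T p q k q) (\<lambda>h. map (\<lambda>b. fst (run T h b)) (blocks (length p))) 200 [w] [])"

definition pow_word :: "nat \<Rightarrow> bool list \<Rightarrow> bool list" where
  "pow_word n p = concat (replicate n p)"

lemma run_fixes: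
  assumes "run T h p = (h, p)"
  shows "ev T h (pow_word m p) = pow_word m p"
proof (induction m)
  case (Suc m)
  have "ev T h p = p" "fst (run T h p) = h" using assms by (auto simp flip: run_eq)
  then show ?case using Suc by (simp add: pow_word_def ev_append_word)
qed (simp add: pow_word_def)

lemma last_block_run:
  assumes "last_block T p k (h, c) = (h', c')" "length c = length p"
  shows "fst (run T h (pow_word k p)) = h' \<and>
    (c' = c \<and> ev T h (pow_word k p) = pow_word k p \<or>
     (\<exists>us j. ev T h (pow_word k p) = us @ c' @ pow_word j p \<and> length p dvd length us))"
  using assms
proof (induction k arbitrary: h c)
  case 0
  then show ?case by (simp add: pow_word_def)
next
  case (Suc k)
  obtain h1 y where r: "run T h p = (h1, y)" by fastforce
  have y: "ev T h p = y" "length y = length p" using r length_ev[of T h p] by (auto simp flip: run_eq)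
  define c1 where "c1 = (if y = p then c else y)"
  have pw: "pow_word (Suc k) p = p @ pow_word k p" by (simp add: pow_word_def)
  have "last_block T p k (h1, c1) = (h', c')" "length c1 = length p"
    using Suc.prems r y by (auto simp: c1_def)
  note IH = Suc.IH[OF this]
  have f: "fst (run T h (pow_word (Suc k) p)) = h'"
    using IH r by (simp add: pw run_append)
  have e: "ev T h (pow_word (Suc k) p) = y @ ev T h1 (pow_word k p)"
    using r y by (simp add: pw ev_append_word)
  from IH consider "c' = c1" "ev T h1 (pow_word k p) = pow_word k p"
    | us j where "ev T h1 (pow_word k p) = us @ c' @ pow_word j p" "length p dvd length us"
    by blast
  then show ?case
  proof cases
    case 1
    have "c' = c \<and> ev T h (pow_word (Suc k) p) = pow_word (Suc k) p \<or>
      ev T h (pow_word (Suc k) p) = [] @ c' @ pow_word k p \<and> length p dvd length ([] :: bool list)"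
      using 1 by (auto simp: e[unfolded pw] c1_def pw)
    then show ?thesis using f by blast
  next
    case 2
    then have "ev T h (pow_word (Suc k) p) = (y @ us) @ c' @ pow_word j p \<and> length p dvd length (y @ us)"
      by (simp add: e y)
    then show ?thesis using f by blast
  qed
qed

lemma pow_word_add: "pow_word (m + n) p = pow_word m p @ pow_word n p"
  by (simp add: pow_word_def replicate_add)

text \<open>Alignment is what matters here: at other offsets a rotation of \<open>p\<close>
  different from \<open>p\<close> can occur inside a power of \<open>p\<close>.\<close>

lemma pow_word_block:
  assumes "pow_word m p = us @ q @ r" "length q = length p" "length p dvd length us"
  shows "q = p"
  using assms
proof (induction m arbitrary: us)
  case (Suc m)
  have e: "p @ pow_word m p = us @ q @ r" using Suc.prems(1) by (simp add: pow_word_def)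
  show ?case
  proof (cases "us = []")
    case False
    then have "length p \<le> length us" using Suc.prems(3) by (auto dest: dvd_imp_le)
    with e obtain us' where us: "us = p @ us'"
      by (metis append_eq_append_conv_if append_take_drop_id)
    then have "length p dvd length us'" using Suc.prems(3) by simp
    with Suc.IH[of us'] e us Suc.prems(2) show ?thesis by simp
  qed (use e Suc.prems in simp)
qed (simp add: pow_word_def)

text \<open>Long finite powers of \<open>p\<close> stand in for the infinite sequence: one
  application uses up at most \<open>k\<close> of the trailing copies.\<close>

lemma pushesD:
  assumes "pushes T p q k b h" "length b = length p"
  shows "\<exists>us j. ev T h (b @ pow_word (k + m) p) = us @ q @ pow_word j p \<and> m \<le> j \<and> length p dvd length us"
proof -
  obtain h1 y where r: "run T h b = (h1, y)" by fastforce
  have y: "ev T h b = y" "length y = length p"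
    using r length_ev[of T h b] assms by (auto simp flip: run_eq)
  obtain h' where l: "last_block T p k (h1, y) = (h', q)" and f: "run T h' p = (h', p)"
    using assms(1) r by (auto simp: pushes_def split: prod.splits)
  have e: "ev T h (b @ pow_word (k + m) p) = y @ ev T h1 (pow_word k p) @ pow_word m p"
    using last_block_run[OF l y(2)] run_fixes[OF f] r y
    by (simp add: pow_word_add ev_append_word)
  from last_block_run[OF l y(2)] consider "q = y" "ev T h1 (pow_word k p) = pow_word k p"
    | us j where "ev T h1 (pow_word k p) = us @ q @ pow_word j p" "length p dvd length us"
    by blast
  then show ?thesis
  proof cases
    case 1
    then show ?thesis using e by (intro exI[of _ "[]"] exI[of _ "k + m"]) (simp add: pow_word_add)
  next
    case 2
    then show ?thesis using e y by (intro exI[of _ "y @ us"] exI[of _ "j + m"]) (simp add: pow_word_add)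
  qed
qed

lemma not_exponent_ratchet:
  assumes "ratchet T (w, p, q, k)"
  shows "\<not> exponent T w n"
proof
  assume ex: "exponent T w n"
  have qp: "q \<noteq> p" "length q = length p" and start: "pushes T p q k p w"
    using assms by auto
  have "explore (pushes T p q k q) (\<lambda>h. map (\<lambda>b. fst (run T h b)) (blocks (length p))) 200 [w] []"
    using assms by simp
  from explore_invariant[OF this] obtain S where w: "w \<in> S"
    and S: "\<forall>h\<in>S. pushes T p q k q h \<and> set (map (\<lambda>b. fst (run T h b)) (blocks (length p))) \<subseteq> S"
    by blast
  have push: "pushes T p q k q h" if "h \<in> S" for h using S that by blast
  have block_S: "fst (run T h b) \<in> S" if "h \<in> S" "length b = length p" for h b
  proof -
    have "b \<in> set (blocks (length p))" using that(2) by (auto simp: blocks_def set_n_lists)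
    with S that(1) show ?thesis by auto
  qed
  have run_S: "fst (run T h us) \<in> S" if "h \<in> S" "length us = i * length p" for h us i
    using that
  proof (induction i arbitrary: h us)
    case (Suc i)
    have "fst (run T h (take (length p) us)) \<in> S" using Suc.prems by (intro block_S) auto
    with Suc.IH[of _ "drop (length p) us"] Suc.prems
    have "fst (run T (fst (run T h (take (length p) us))) (drop (length p) us)) \<in> S" by simp
    then show ?case using run_append[of T h "take (length p) us" "drop (length p) us"] by simp
  qed simp
  \<comment> \<open>The set preserved by \<open>w\<close>, up to the loss of \<open>k\<close>
    guaranteed trailing copies of \<open>p\<close> per application.\<close>
  define Y where "Y m = {v. \<exists>us j. v = us @ q @ pow_word j p \<and> m \<le> j \<and> length p dvd length us}" for m
  have Y_step: "ev T w v \<in> Y m" if "v \<in> Y (k + m)" for v m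
  proof -
    obtain us i where i: "v = us @ q @ pow_word i p" "k + m \<le> i" "length p dvd length us"
      using \<open>v \<in> Y (k + m)\<close> unfolding Y_def by blast
    then obtain j where "i = k + (m + j)" by (metis add.assoc le_iff_add)
    with i have v: "v = us @ q @ pow_word (k + (m + j)) p" "length p dvd length us" by simp_all
    have "fst (run T w us) \<in> S" using run_S[OF w] v(2) by (metis dvd_def mult.commute)
    from pushesD[OF push[OF this] qp(2), of "m + j"] obtain us' j'
      where "ev T (fst (run T w us)) (q @ pow_word (k + (m + j)) p) = us' @ q @ pow_word j' p"
        "m + j \<le> j'" "length p dvd length us'" by blast
    then have "ev T w v = (ev T w us @ us') @ q @ pow_word j' p \<and> m \<le> j' \<and>
        length p dvd length (ev T w us @ us')"
      using v by (simp add: ev_append_word)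
    then show ?thesis unfolding Y_def by blast
  qed
  \<comment> \<open>The start provides \<open>k\<close> copies for each application and
    \<open>m\<close> in reserve.\<close>
  have pow: "(ev T w ^^ Suc i) (p @ pow_word (k * Suc i + m) p) \<in> Y m" for i m
  proof (induction i arbitrary: m)
    case 0
    show ?case using pushesD[OF start refl, of m] by (auto simp: Y_def)
  next
    case (Suc i)
    have e: "k * Suc (Suc i) + m = k * Suc i + (k + m)" by simp
    show ?case using Y_step[OF Suc.IH[of "k + m"]] by (simp only: e funpow.simps comp_apply)
  qed
  obtain i where i: "n = Suc i" using ex by (auto simp: exponent_def gr0_conv_Suc)
  have "(ev T w ^^ Suc i) v = v" for v
    using ex unfolding exponent_def i by (simp only: id_apply)
  with pow[of i 0] have "p @ pow_word (k * n) p \<in> Y 0" by (simp only: i add_0_right)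
  \<comment> \<open>The fixed word is itself a power of \<open>p\<close>, yet it would contain the
    block \<open>q\<close> at an aligned position.\<close>
  then have "pow_word (Suc (k * n)) p \<in> Y 0" by (simp add: pow_word_def)
  then obtain us j where "pow_word (Suc (k * n)) p = us @ q @ pow_word j p" "length p dvd length us"
    unfolding Y_def by blast
  from pow_word_block[OF this(1) qp(2) this(2)] qp(1) show False by contradiction
qed

section \<open>Elements of infinite order from parities\<close>

text \<open>
  Modulo 2, the number of active sections of a word at the next level depends linearly on the numbers of
  occurrences of the three states. A word for which it is odd at all levels acts transitively on each of them.
\<close>

fun plus_vec :: "bool \<times> bool \<times> bool \<Rightarrow> bool \<times> bool \<times> bool \<Rightarrow> bool \<times> bool \<times> bool" where
  "plus_vec (a, b, c) (a', b', c') = (a \<noteq> a', b \<noteq> b', c \<noteq> c')"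

fun unit_vec :: "st \<Rightarrow> bool \<times> bool \<times> bool" where
  "unit_vec S0 = (True, False, False)"
| "unit_vec S1 = (False, True, False)"
| "unit_vec S2 = (False, False, True)"

definition scale_vec :: "bool \<Rightarrow> bool \<times> bool \<times> bool \<Rightarrow> bool \<times> bool \<times> bool" where
  "scale_vec x v = (if x then v else (False, False, False))"

fun linear_vec :: "(st \<Rightarrow> bool \<times> bool \<times> bool) \<Rightarrow> bool \<times> bool \<times> bool \<Rightarrow> bool \<times> bool \<times> bool" where
  "linear_vec f (a, b, c) =
     plus_vec (scale_vec a (f S0)) (plus_vec (scale_vec b (f S1)) (scale_vec c (f S2)))"

definition sections_vec :: "table \<Rightarrow> bool \<times> bool \<times> bool \<Rightarrow> bool \<times> bool \<times> bool" where
  "sections_vec T =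
     linear_vec (\<lambda>s. plus_vec (unit_vec (nxt T s False)) (unit_vec (nxt T s True)))"

fun odd_vec :: "table \<Rightarrow> bool \<times> bool \<times> bool \<Rightarrow> bool" where
  "odd_vec T (a, b, c) = ((a \<and> act T S0) \<noteq> ((b \<and> act T S1) \<noteq> (c \<and> act T S2)))"

text \<open>There are 8 vectors, and one more call meets the first repetition, so 9 calls always
  suffice.\<close>

definition transitive_vec :: "table \<Rightarrow> bool \<times> bool \<times> bool \<Rightarrow> bool" where
  "transitive_vec T v = explore (odd_vec T) (\<lambda>v. [sections_vec T v]) 9 [v] []"

fun vec :: "letter list \<Rightarrow> bool \<times> bool \<times> bool" where
  "vec [] = (False, False, False)"
| "vec (l # w) = plus_vec (unit_vec (fst l)) (vec w)"

lemma plus_vec_assoc: "plus_vec (plus_vec u v) w = plus_vec u (plus_vec v w)"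
  by (cases u; cases v; cases w) auto

lemma plus_vec_commute: "plus_vec u v = plus_vec v u"
  by (cases u; cases v) auto

lemma plus_vec_left_commute: "plus_vec u (plus_vec v w) = plus_vec v (plus_vec u w)"
  by (metis plus_vec_assoc plus_vec_commute)

lemmas plus_vec_ac = plus_vec_assoc plus_vec_commute plus_vec_left_commute

lemma vec_append: "vec (u @ v) = plus_vec (vec u) (vec v)"
proof (induction u)
  case Nil
  show ?case by (cases "vec v") auto
qed (simp add: plus_vec_assoc)

lemma linear_vec_zero [simp]: "linear_vec f (False, False, False) = (False, False, False)"
  by (simp add: scale_vec_def)

lemma linear_vec_Cons: "linear_vec f (plus_vec (unit_vec s) v) = plus_vec (f s) (linear_vec f v)"
proof (cases v)
  case (fields a b c)
  obtain x0 x1 x2 y0 y1 y2 z0 z1 z2 where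
    "f S0 = (x0, x1, x2)" "f S1 = (y0, y1, y2)" "f S2 = (z0, z1, z2)"
    by (metis surj_pair)
  then show ?thesis using fields by (cases s; cases a; cases b; cases c) (auto simp: scale_vec_def)
qed

lemma odd_vec_Cons: "odd_vec T (plus_vec (unit_vec s) v) = (act T s \<noteq> odd_vec T v)"
  by (cases v; cases s) auto

lemma snd_step: "snd (step T w x) = (x \<noteq> odd_vec T (vec w))"
proof (induction w arbitrary: x)
  case (Cons l w)
  have "snd (step T (l # w) x) = snd (step T w (x \<noteq> act T (fst l)))" by (simp add: split_beta)
  also have "\<dots> = ((x \<noteq> act T (fst l)) \<noteq> odd_vec T (vec w))" by (rule Cons)
  also have "\<dots> = (x \<noteq> (act T (fst l) \<noteq> odd_vec T (vec w)))" by argo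
  finally show ?case by (simp only: vec.simps odd_vec_Cons)
qed simp

text \<open>An inverse letter and an active letter before it can only exchange the two sections that
  a letter contributes, and the sum of the two does not notice this.\<close>

lemma vec_sections:
  "plus_vec (vec (fst (step T w x))) (vec (fst (step T w (\<not> x)))) = sections_vec T (vec w)"
proof (induction w arbitrary: x)
  case Nil
  show ?case by (simp add: sections_vec_def del: linear_vec.simps)
next
  case (Cons l w)
  obtain s i where l: "l = (s, i)" by fastforce
  have "plus_vec (vec (fst (step T (l # w) x))) (vec (fst (step T (l # w) (\<not> x)))) =
    plus_vec (plus_vec (unit_vec (fst (lnxt T l x))) (unit_vec (fst (lnxt T l (\<not> x)))))
     (plus_vec (vec (fst (step T w (x \<noteq> act T s)))) (vec (fst (step T w (\<not> (x \<noteq> act T s))))))"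
    by (auto simp: l plus_vec_ac split: prod.splits)
  also have "plus_vec (vec (fst (step T w (x \<noteq> act T s)))) (vec (fst (step T w (\<not> (x \<noteq> act T s))))) =
     sections_vec T (vec w)" by (rule Cons)
  also have "plus_vec (unit_vec (fst (lnxt T l x))) (unit_vec (fst (lnxt T l (\<not> x)))) =
     plus_vec (unit_vec (nxt T s False)) (unit_vec (nxt T s True))"
    by (cases x; cases i; cases "act T s") (auto simp: l plus_vec_commute)
  finally show ?case by (simp add: l sections_vec_def linear_vec_Cons)
qed

text \<open>The section of the square at a moved letter is the product of both sections of the word,
  so its vector stays in the closed set \<open>S\<close>, and exponents would decrease
  forever.\<close>

lemma not_exponent_transitive:
  assumes "transitive_vec T (vec w)"
  shows "\<not> exponent T w n"
proof -
  from explore_invariant[OF assms[unfolded transitive_vec_def]] obtain S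
    where w: "vec w \<in> S" and S: "\<forall>v\<in>S. odd_vec T v \<and> set [sections_vec T v] \<subseteq> S" by blast
  have "\<not> exponent T v n" if "vec v \<in> S" for v
    using that
  proof (induction n arbitrary: v rule: less_induct)
    case (less n)
    have odd: "snd (step T v False)" using S less.prems by (simp add: snd_step)
    have "vec (fst (step T (v @ v) False)) = sections_vec T (vec v)"
      using vec_sections[of T v False] odd by (simp add: step_append vec_append)
    then have "vec (fst (step T (v @ v) False)) \<in> S" using S less.prems by simp
    with less.IH have "\<not> exponent T (fst (step T (v @ v) False)) m" if "m < n" for m
      using that by blast
    then show ?case using exponent_square[of T v n False] odd by (metis (full_types))
  qed
  from this[OF w] show ?thesis .
qed

section \<open>Finite groups\<close>

definition positive :: "st set \<Rightarrow> letter list set" where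
  "positive X = {w. \<forall>l\<in>set w. fst l \<in> X \<and> \<not> snd l}"

lemma positive_simps [simp]:
  "[] \<in> positive X" "l # w \<in> positive X \<longleftrightarrow> fst l \<in> X \<and> \<not> snd l \<and> w \<in> positive X"
  "u @ v \<in> positive X \<longleftrightarrow> u \<in> positive X \<and> v \<in> positive X"
  by (auto simp: positive_def)

lemma positive_section:
  assumes "w \<in> positive X" "\<And>s y. s \<in> X \<Longrightarrow> nxt T s y \<in> Y"
  shows "fst (step T w x) \<in> positive Y"
  using assms(1)
proof (induction w arbitrary: x)
  case (Cons l w)
  then show ?case using assms(2) by (cases l) (auto split: prod.splits; metis fst_conv)
qed simp

text \<open>An element is determined by its action on the first letter and its two sections;
  \<open>G\<close> rebuilds it from these data.\<close>

lemma finite_positive_lift: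
  assumes fin: "finite (ev T ` positive Y)" and "\<And>s y. s \<in> X \<Longrightarrow> nxt T s y \<in> Y"
  shows "finite (ev T ` positive X)"
proof -
  define G where "G = (\<lambda>(b, f, g) u. case u of [] \<Rightarrow> []
    | x # v \<Rightarrow> (x \<noteq> b) # (if x then f v else g v :: bool list))"
  have "ev T w \<in> G ` (UNIV \<times> ev T ` positive Y \<times> ev T ` positive Y)" if "w \<in> positive X" for w
  proof -
    have "ev T w = G (odd_vec T (vec w), ev T (fst (step T w True)), ev T (fst (step T w False)))"
      by (rule ext) (auto simp: G_def snd_step split: list.splits)
    then show ?thesis using positive_section[OF that assms(2)] by blast
  qed
  then have "ev T ` positive X \<subseteq> G ` (UNIV \<times> ev T ` positive Y \<times> ev T ` positive Y)" by blast
  moreover have "finite (UNIV \<times> ev T ` positive Y \<times> ev T ` positive Y :: (bool \<times> _) set)"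
    using fin by (intro finite_cartesian_product) auto
  ultimately show ?thesis by (meson finite_imageI finite_subset)
qed

text \<open>
  If both sections of each state in \<open>X\<close> agree and lie in \<open>X\<close>, then a word over \<open>X\<close> flips the letters at
  positions that depend neither on the input nor on the order of its letters.
\<close>

lemma vec_homogeneous_section:
  assumes "\<And>s. s \<in> X \<Longrightarrow> nxt T s False = nxt T s True" "w \<in> positive X"
  shows "vec (fst (step T w x)) = linear_vec (\<lambda>s. unit_vec (nxt T s False)) (vec w)"
  using assms(2)
proof (induction w arbitrary: x)
  case (Cons l w)
  obtain s i where l: "l = (s, i)" by fastforce
  have "nxt T s x = nxt T s False" using Cons.prems l assms(1)[of s] by (cases x) auto
  with Cons l show ?case by (simp add: linear_vec_Cons split_beta)
qed (simp del: linear_vec.simps)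

lemma finite_homogeneous:
  assumes "\<And>s. s \<in> X \<Longrightarrow> nxt T s False = nxt T s True" "\<And>s y. s \<in> X \<Longrightarrow> nxt T s y \<in> X"
  shows "finite (ev T ` positive X)"
proof -
  have eq: "ev T v u = ev T w u" if "v \<in> positive X" "w \<in> positive X" "vec v = vec w" for v w u
    using that
  proof (induction u arbitrary: v w)
    case (Cons x u)
    have "vec (fst (step T v x)) = vec (fst (step T w x))"
      using vec_homogeneous_section[of X T v x] vec_homogeneous_section[of X T w x] assms(1) Cons.prems
      by metis
    then have "ev T (fst (step T v x)) u = ev T (fst (step T w x)) u"
      using Cons.prems assms(2) by (intro Cons.IH positive_section[of _ X]) auto
    then show ?case using Cons.prems by (simp add: snd_step)
  qed simp
  \<comment> \<open>By \<open>eq\<close> the action depends only on the vector, so one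
    representative for each of the 8 vectors is enough.\<close>
  define r where "r v = (SOME w. w \<in> positive X \<and> vec w = v)" for v
  have r: "r (vec w) \<in> positive X \<and> vec (r (vec w)) = vec w" if "w \<in> positive X" for w
    unfolding r_def by (rule someI[of _ w]) (use that in auto)
  have "ev T w = ev T (r (vec w))" if "w \<in> positive X" for w
    using r[OF that] that by (intro ext eq) simp_all
  then have "ev T ` positive X \<subseteq> (\<lambda>v. ev T (r v)) ` UNIV" by blast
  then show ?thesis by (rule finite_subset) simp
qed

text \<open>Composition with a generator is an injective map of the finite monoid into itself, hence
  onto; whatever it sends to \<open>id\<close> is the inverse of the generator.\<close>

lemma finite_range_ev:
  assumes fin: "finite (ev T ` positive UNIV)"
  shows "finite (range (ev T))"
proof -
  let ?M = "ev T ` positive UNIV"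
  have comp: "f \<circ> g \<in> ?M" if "f \<in> ?M" "g \<in> ?M" for f g
  proof -
    from that obtain v w where "f = ev T v" "g = ev T w" "w @ v \<in> positive UNIV" by auto
    moreover have "ev T v \<circ> ev T w = ev T (w @ v)" by (auto simp: ev_append)
    ultimately show ?thesis by blast
  qed
  have id: "id \<in> ?M" by (rule image_eqI[where x = "[]"]) (simp_all only: ev_Nil_id positive_simps)
  have letter: "ev T [l] \<in> ?M" for l
  proof (cases l)
    case (Pair s i)
    have pos: "ev T [(s, False)] \<in> ?M" by auto
    have "inj_on (\<lambda>g. ev T [(s, False)] \<circ> g) ?M"
    proof (rule inj_onI)
      fix g h assume "ev T [(s, False)] \<circ> g = ev T [(s, False)] \<circ> h"
      then have "ev T [(s, False)] (g u) = ev T [(s, False)] (h u)" for u by (metis comp_apply)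
      then show "g = h" by (metis ev_inv_word ext)
    qed
    then have "(\<lambda>g. ev T [(s, False)] \<circ> g) ` ?M = ?M"
      using comp[OF pos] by (intro endo_inj_surj[OF fin]) auto
    with id obtain g where g: "g \<in> ?M" "id = ev T [(s, False)] \<circ> g" by blast
    have "g u = ev T [(s, True)] u" for u
      using ev_inv_word[of T "[(s, False)]" "g u"] g(2) by (simp add: fun_eq_iff)
    with g(1) have "ev T [(s, True)] \<in> ?M" by (metis ext)
    with pos Pair show ?thesis by (cases i) auto
  qed
  have "ev T w \<in> ?M" for w
  proof (induction w)
    case Nil
    show ?case by (rule imageI) simp
  next
    case (Cons l w)
    then show ?case using comp[OF Cons letter[of l]] by (simp only: ev_Cons[of T l w])
  qed
  then have "range (ev T) \<subseteq> ?M" by blast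
  then show ?thesis using fin by (rule finite_subset)
qed

definition states :: "st list" where
  "states = [S0, S1, S2]"

definition both_in :: "table \<Rightarrow> st list \<Rightarrow> st \<Rightarrow> bool" where
  "both_in T H s = (nxt T s False \<in> set H \<and> nxt T s True \<in> set H)"

definition homogeneous :: "table \<Rightarrow> st list \<Rightarrow> st list" where
  "homogeneous T H = filter (\<lambda>s. nxt T s False = nxt T s True \<and> both_in T H s) H"

text \<open>With three states, three rounds bring the shrinking set \<open>H\<close> to its fixed
  point, and three rounds do the same for the growing sets lifted from it.\<close>

definition finite_table :: "table \<Rightarrow> bool" where
  "finite_table T =
     (let H = homogeneous T (homogeneous T (homogeneous T states));
          step = (\<lambda>R. filter (both_in T R) states)
      in homogeneous T H = H \<and> step (step (step H)) = states)"

lemma set_states: "set states = UNIV"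
  unfolding states_def by (auto intro: st.exhaust)

lemma finite_table_sound:
  assumes "finite_table T"
  shows "finite (range (ev T))"
proof -
  define lift where "lift R = filter (both_in T R) states" for R
  obtain H where H: "homogeneous T H = H" "lift (lift (lift H)) = states"
    using assms unfolding finite_table_def lift_def Let_def by blast
  have lift: "finite (ev T ` positive (set (lift R)))" if "finite (ev T ` positive (set R))" for R
    using that by (rule finite_positive_lift) (auto simp: lift_def both_in_def split: if_splits, (metis (full_types))+)
  have hom: "nxt T s False = nxt T s True \<and> nxt T s y \<in> set H" if "s \<in> set H" for s y
    using that arg_cong[OF H(1), of set] by (cases y) (auto simp: homogeneous_def both_in_def)
  then have "finite (ev T ` positive (set H))" by (intro finite_homogeneous) auto
  from lift[OF lift[OF lift[OF this]]] show ?thesis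
    by (intro finite_range_ev) (simp add: H(2) set_states)
qed

text \<open>A bisimulation between two words. Comparing the images of one letter suffices, since by
  \<open>snd_step\<close> a word flips either both letters or neither.\<close>

definition equal_words :: "table \<Rightarrow> letter list \<Rightarrow> letter list \<Rightarrow> bool" where
  "equal_words T u v = explore
     (\<lambda>(u, v). snd (step T u False) = snd (step T v False))
     (\<lambda>(u, v). if u = v then [] else map (\<lambda>x. (fst (step T u x), fst (step T v x))) [False, True])
     100 [(u, v)] []"

definition closed_words :: "table \<Rightarrow> letter list list \<Rightarrow> bool" where
  "closed_words T W = list_all (\<lambda>w. list_all (\<lambda>s.
     list_ex (equal_words T (w @ [(s, False)])) W) states) W"

lemma equal_words_sound:
  assumes "equal_words T u v"
  shows "ev T u = ev T v"
proof
  from explore_invariant[OF assms[unfolded equal_words_def]] obtain S where uv: "(u, v) \<in> S"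
    and S: "\<forall>h\<in>S. (case h of (u, v) \<Rightarrow> snd (step T u False) = snd (step T v False)) \<and>
      set (case h of (u, v) \<Rightarrow> if u = v then []
        else map (\<lambda>x. (fst (step T u x), fst (step T v x))) [False, True]) \<subseteq> S"
    by blast
  have snd: "snd (step T u False) = snd (step T v False)" if "(u, v) \<in> S" for u v
    using bspec[OF S that] by simp
  have fst: "(fst (step T u x), fst (step T v x)) \<in> S" if "(u, v) \<in> S" "u \<noteq> v" for u v x
    using bspec[OF S that(1)] that(2) by (cases x) simp_all
  fix t
  have "ev T u t = ev T v t" if "(u, v) \<in> S" for u v
    using that
  proof (induction t arbitrary: u v)
    case (Cons x t)
    show ?case
    proof (cases "u = v")
      case False
      have "snd (step T u x) = snd (step T v x)" using snd[OF Cons.prems] by (simp add: snd_step)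
      with Cons.IH[OF fst[OF Cons.prems False, of x]] show ?thesis by simp
    qed simp
  qed simp
  from this[OF uv] show "ev T u t = ev T v t" .
qed

lemma closed_words_sound:
  assumes "closed_words T W" "[] \<in> set W"
  shows "finite (range (ev T))"
proof (rule finite_range_ev)
  have "ev T w \<in> ev T ` set W" if "w \<in> positive UNIV" for w
    using that
  proof (induction w rule: rev_induct)
    case (snoc l w)
    then obtain v where v: "v \<in> set W" "ev T w = ev T v" by auto
    obtain s where l: "l = (s, False)" using snoc.prems by (cases l) auto
    from assms(1) v(1) obtain v' where v': "v' \<in> set W" "equal_words T (v @ [(s, False)]) v'"
      by (auto simp: closed_words_def list_all_iff list_ex_iff set_states)
    have "ev T (u @ [l]) = ev T [l] \<circ> ev T u" for u by (auto simp: ev_append)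
    then have "ev T (w @ [l]) = ev T v'"
      using equal_words_sound[OF v'(2)] v(2) l by metis
    with v'(1) show ?case by blast
  qed (use assms(2) in auto)
  then have "ev T ` positive UNIV \<subseteq> ev T ` set W" by blast
  then show "finite (ev T ` positive UNIV)" by (rule finite_subset) simp
qed

section \<open>Identifying states\<close>

fun merge :: "(st \<Rightarrow> st) \<Rightarrow> table \<Rightarrow> table" where
  "merge p (i, (a, b), (c, d), (e, f)) = (i, (p a, p b), (p c, p d), (p e, p f))"

definition congruence :: "table \<Rightarrow> (st \<Rightarrow> st) \<Rightarrow> bool" where
  "congruence T p = list_all (\<lambda>s. act T (p s) = act T s \<and>
     p (nxt T (p s) False) = p (nxt T s False) \<and> p (nxt T (p s) True) = p (nxt T s True)) states"

definition identify :: "st \<Rightarrow> st \<Rightarrow> st \<Rightarrow> st" where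
  "identify a b s = (if s = b then a else s)"

text \<open>When one or two states are active in sorted order, exactly one pair of states has equal
  activities, and only this pair can be identified.\<close>

definition minimize :: "table \<Rightarrow> table" where
  "minimize T = (let p = (if act T S0 = act T S1 then identify S0 S1 else identify S1 S2)
     in if congruence T p then merge p T else T)"

definition finite_or_non_torsion :: "table \<Rightarrow> bool" where
  "finite_or_non_torsion T \<longleftrightarrow> finite (range (ev T)) \<or> (\<exists>w. \<forall>n. \<not> exponent T w n)"

text \<open>Two words are compared because sections taken in the merged table agree with the
  original ones only up to \<open>p\<close>.\<close>

lemma ev_merge:
  assumes c: "congruence T p" and idem: "\<And>s. p (p s) = p s"
    and "list_all2 (\<lambda>l l'. snd l = snd l' \<and> p (fst l) = p (fst l')) v w"
  shows "ev T v u = ev (merge p T) w u"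
  using assms(3)
proof (induction u arbitrary: v w)
  case (Cons x u)
  have c: "act T (p s) = act T s" "p (nxt T (p s) y) = p (nxt T s y)" for s y
    using c by (cases y; simp add: congruence_def list_all_iff set_states)+
  have act: "act (merge p T) s = act T s" for s
    by (cases "(p, T)" rule: merge.cases) (cases s; auto)
  have nxt: "nxt (merge p T) s y = p (nxt T s y)" for s y
    by (cases "(p, T)" rule: merge.cases) (cases s; auto simp: nxt_def)
  have "list_all2 (\<lambda>l l'. snd l = snd l' \<and> p (fst l) = p (fst l')) (fst (step T v y)) (fst (step (merge p T) w y))
    \<and> snd (step T v y) = snd (step (merge p T) w y)" for y
    using Cons.prems
  proof (induction v w arbitrary: y rule: list_all2_induct)
    case (Cons l v l' w)
    obtain s t i where l: "l = (s, i)" "l' = (t, i)" "p s = p t"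
      using Cons.hyps(1) by (cases l; cases l') auto
    have "act T s = act T t" "p (nxt T s z) = p (nxt T t z)" for z using c l(3) by metis+
    then show ?case using Cons.IH[of "y \<noteq> act T s"] by (auto simp: l act nxt idem split: prod.splits)
  qed simp
  from this[of x] Cons.IH show ?case by auto
qed simp

lemma finite_or_non_torsion_merge:
  assumes "congruence T p" "\<And>s. p (p s) = p s" "finite_or_non_torsion (merge p T)"
  shows "finite_or_non_torsion T"
proof -
  have "ev T = ev (merge p T)"
    by (intro ext ev_merge[OF assms(1,2)]) (simp add: list_all2_same)
  with assms(3) show ?thesis by (simp add: finite_or_non_torsion_def exponent_def)
qed

lemma finite_or_non_torsion_minimize:
  "finite_or_non_torsion (minimize T) \<Longrightarrow> finite_or_non_torsion T"
  by (auto simp: minimize_def Let_def identify_def intro: finite_or_non_torsion_merge split: if_splits)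

lemma finite_or_non_torsion_constant:
  assumes "\<And>s. act T s = act T S0"
  shows "finite_or_non_torsion T"
proof (rule finite_or_non_torsion_merge)
  show "congruence T (\<lambda>_. S0)" unfolding congruence_def list_all_iff
    by (intro ballI conjI refl assms[symmetric])
  have "merge (\<lambda>_. S0) T = (fst T, (S0, S0), (S0, S0), (S0, S0))"
    by (cases "(\<lambda>_ :: st. S0, T)" rule: merge.cases) simp
  then have "finite_table (merge (\<lambda>_. S0) T)"
    by (simp add: finite_table_def homogeneous_def both_in_def states_def nxt_def)
  then show "finite_or_non_torsion (merge (\<lambda>_. S0) T)"
    using finite_table_sound finite_or_non_torsion_def by blast
qed simp

section \<open>The certificates\<close>

text \<open>
  The certificates were found by computer search. Every minimized table with exactly one or two active
  states passes one of the five tests; the dihedral group of order 8 is needed for four of them.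
\<close>

definition dihedral_words :: "st \<Rightarrow> st \<Rightarrow> letter list list" where
  "dihedral_words s t = (let b = (s, False); c = (t, False) in
     [[], [b], [c], [b, c], [c, b], [b, c, b], [c, b, c], [b, c, b, c]])"

definition known_ratchets :: "(letter list \<times> bool list \<times> bool list \<times> nat) list" where
  "known_ratchets =
    (let a = (S0, False); b = (S1, False); c = (S2, False);
         a' = (S0, True); b' = (S1, True); c' = (S2, True) in
    [([a', c'], [True], [False], 4),
     ([c, a], [True], [False], 4),
     ([c], [False], [True], 2),
     ([c'], [False], [True], 2),
     ([a', c'], [False], [True], 3),
     ([a, b], [False], [True], 2),
     ([a, c], [True], [False], 2),
     ([b, c], [False, False], [True, False], 1),
     ([b, c'], [True, True], [False, True], 1),
     ([a, c], [False, False], [True, False], 1),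
     ([a', c'], [True, True], [False, True], 1),
     ([b', a'], [False, True], [True, True], 1),
     ([b, a], [False, True], [True, True], 1),
     ([c', a], [True, True], [False, True], 1),
     ([c, a'], [True, True], [False, True], 1),
     ([a', b'], [False], [True], 2),
     ([b, a'], [True, True], [False, True], 1),
     ([b', a], [True, True], [False, True], 1)])"

definition known_returns :: "(letter list \<times> bool list) list" where
  "known_returns =
    (let a = (S0, False); b = (S1, False); c = (S2, False);
         a' = (S0, True); b' = (S1, True); c' = (S2, True) in
    [([b, c'], [True, True]),
     ([a', b], [True, False, True]),
     ([a', c], [True, True]),
     ([c, a'], [True, False, False]),
     ([a, b'], [False, False]),
     ([c, a'], [True, False, True, False]),
     ([a, b', c, b'], [False, True]),
     ([b', c], [False, True, False]),
     ([a, c', b, c'], [False, True]),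
     ([a, b'], [True, False]),
     ([a, c', a, b'], [False, False]),
     ([a', c], [False, True]),
     ([b', c], [True, False, True]),
     ([b, a'], [False, True, False, False]),
     ([c', b], [True, False, False, False]),
     ([a, b', c', b], [False, True]),
     ([a, b, c', c'], [True, True])])"

definition certified :: "table \<Rightarrow> bool" where
  "certified T \<longleftrightarrow>
     list_ex (transitive_vec T) [(True, True, False), (True, False, True), (False, True, True)] \<or>
     finite_table T \<or>
     list_ex (ratchet T) known_ratchets \<or>
     list_ex (returns T) known_returns \<or>
     list_ex (closed_words T) [dihedral_words S0 S2, dihedral_words S1 S2]"

definition rows :: "(st \<times> st) list" where
  "rows = List.product states states"

definition certified_from :: "bool \<times> bool \<times> bool \<Rightarrow> st \<times> st \<Rightarrow> bool" where
  "certified_from i r = list_all (\<lambda>r'. list_all (\<lambda>r''. certified (minimize (i, r, r', r''))) rows) rows"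

lemma certified_sound:
  assumes "certified T"
  shows "finite_or_non_torsion T"
proof -
  have "[] \<in> set (dihedral_words s t)" for s t by (simp add: dihedral_words_def Let_def)
  moreover have "\<exists>w. vec w = v" if "v \<in> {(True, True, False), (True, False, True), (False, True, True)}" for v
    using that by (auto intro: exI[of _ "[(S0, False), (S1, False)]"] exI[of _ "[(S0, False), (S2, False)]"]
      exI[of _ "[(S1, False), (S2, False)]"])
  ultimately show ?thesis
    using assms unfolding certified_def finite_or_non_torsion_def list_ex_iff
    by (metis finite_table_sound closed_words_sound not_exponent_transitive not_exponent_ratchet
        not_exponent_returns list.set_intros insert_iff list.set(2) list.set(1) prod_cases4 surj_pair empty_iff)
qed

lemma certified_from_sound:
  assumes "list_all (certified_from i) rows" "fst T = i"
  shows "finite_or_non_torsion T"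
proof -
  obtain r0 r1 r2 where T: "T = (i, r0, r1, r2)" using assms(2) by (metis surj_pair fst_conv)
  have "r \<in> set rows" for r by (cases r) (simp add: rows_def set_states)
  with assms(1) have "certified (minimize T)"
    unfolding T certified_from_def list_all_iff by blast
  then show ?thesis by (rule finite_or_non_torsion_minimize[OF certified_sound])
qed

lemma certified_one_active: "list_all (certified_from (False, False, True)) rows"
  by code_simp

lemma certified_two_active: "list_all (certified_from (False, True, True)) rows"
  by code_simp

lemma finite_or_non_torsion_sorted:
  assumes "act T S0 \<le> act T S1" "act T S1 \<le> act T S2"
  shows "finite_or_non_torsion T"
proof -
  obtain i j k r where T: "T = ((i, j, k), r)" by (metis surj_pair)
  consider "i = k" "j = k" | "(i, j, k) = (False, False, True)" | "(i, j, k) = (False, True, True)"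
    using assms by (auto simp: T)
  then show ?thesis
  proof cases
    case 1
    have "act T s = act T S0" for s using 1 T by (cases s) auto
    then show ?thesis by (rule finite_or_non_torsion_constant)
  qed (use T certified_from_sound certified_one_active certified_two_active in auto)
qed

section \<open>From tables to automata\<close>

text \<open>The computations use \<open>bool\<close> while the tree uses \<open>bit\<close>; this
  transports maps along the bijection of the alphabets.\<close>

definition on_bits :: "(bool list \<Rightarrow> bool list) \<Rightarrow> word \<Rightarrow> word" where
  "on_bits g w = map of_bool (g (map (\<lambda>x. x = 1) w))"

lemma on_bits_comp: "on_bits (g \<circ> h) = on_bits g \<circ> on_bits h"
  by (simp add: on_bits_def fun_eq_iff comp_def)

lemma on_bits_id: "on_bits id = id"
proof
  fix w :: word
  have "of_bool (x = 1) = x" for x :: bit by (cases x) auto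
  then show "on_bits id w = id w" by (simp add: on_bits_def comp_def)
qed

lemma on_bits_funpow: "on_bits (g ^^ n) = on_bits g ^^ n"
  by (induction n) (simp_all only: funpow.simps on_bits_id on_bits_comp)

lemma on_bits_inject:
  assumes "on_bits g = on_bits h" shows "g = h"
proof
  fix u
  have "on_bits g (map of_bool u) = on_bits h (map of_bool u)" by (simp add: assms)
  then have "map of_bool (g u) = (map of_bool (h u) :: bit list)" by (simp add: on_bits_def comp_def)
  moreover have "inj (of_bool :: bool \<Rightarrow> bit)" by (auto intro!: injI split: if_splits simp: of_bool_def)
  ultimately show "g u = h u" by simp
qed

lemma state_map_eq_ev:
  assumes f: "\<And>s x. f (nxt T s (x = 1)) = succ A (f s) x"
    and e: "\<And>s. expo A (f s) = of_bool (act T s)"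
  shows "state_map A (f s) = on_bits (ev T [(s, False)])"
proof
  fix w show "state_map A (f s) w = on_bits (ev T [(s, False)]) w"
  proof (induction w arbitrary: s)
    case (Cons x w)
    have "(sigma ^^ expo A (f s)) x = of_bool ((x = 1) \<noteq> act T s)"
      by (cases x) (auto simp: e sigma_def)
    then show ?case using Cons[of "nxt T s (x = 1)"] by (simp add: f on_bits_def)
  qed (simp add: on_bits_def)
qed

context
  fixes A :: "'q automaton" and T :: table and f :: "st \<Rightarrow> 'q"
  assumes f: "\<And>s x. f (nxt T s (x = 1)) = succ A (f s) x"
    and e: "\<And>s. expo A (f s) = of_bool (act T s)"
    and surj_f: "surj f"
begin

lemma carrier_automaton_group: "carrier (automaton_group A) = on_bits ` range (ev T)"
proof -
  interpret Aut: group Aut_tree by (rule group_Aut_tree)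
  let ?S = "range (state_map A)"
  have sub: "carrier Aut_tree \<inter> ?S = ?S" by (auto simp: state_map_in_Aut_tree)
  have mult: "x \<otimes>\<^bsub>Aut_tree\<^esub> y = x \<circ> y" for x y by (simp add: Aut_tree_def)
  have unit: "\<one>\<^bsub>Aut_tree\<^esub> = id" by (simp add: Aut_tree_def)
  note state = state_map_eq_ev[OF f e]
  have gen: "state_map A (f s) \<in> ?S" for s by simp
  have inv: "inv\<^bsub>Aut_tree\<^esub> (state_map A (f s)) = on_bits (ev T [(s, True)])" for s
  proof -
    define g where "g = inv\<^bsub>Aut_tree\<^esub> (state_map A (f s))"
    have "g \<circ> state_map A (f s) = id"
      using Aut.l_inv[OF state_map_in_Aut_tree] by (simp add: g_def mult unit)
    moreover have "ev T [(s, False)] \<circ> ev T [(s, True)] = id"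
      using ev_inv_word[of T "[(s, True)]"] by (simp add: fun_eq_iff)
    then have "state_map A (f s) \<circ> on_bits (ev T [(s, True)]) = id"
      by (simp add: state on_bits_id flip: on_bits_comp)
    ultimately show ?thesis unfolding g_def by (metis comp_assoc comp_id id_comp)
  qed
  have "h \<in> on_bits ` range (ev T)" if "h \<in> generate Aut_tree ?S" for h
    using that
  proof induction
    case one
    have "\<one>\<^bsub>Aut_tree\<^esub> = on_bits (ev T [])" by (simp only: unit ev_Nil_id on_bits_id)
    then show ?case by blast
  next
    case (incl h)
    then obtain s where "h = state_map A (f s)" using surj_f by (metis imageE surjD)
    then show ?case by (auto simp: state)
  next
    case (inv h)
    then obtain s where "h = state_map A (f s)" using surj_f by (metis imageE surjD)
    then show ?case using \<open>\<And>s. inv\<^bsub>Aut_tree\<^esub> (state_map A (f s)) = _ s\<close> by auto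
  next
    case (eng h k)
    then obtain u v where "h = on_bits (ev T u)" "k = on_bits (ev T v)" by blast
    \<comment> \<open>The order is reversed because the first letter of a word acts first.\<close>
    moreover have "ev T u \<circ> ev T v = ev T (v @ u)" by (auto simp: ev_append)
    ultimately have "h \<otimes>\<^bsub>Aut_tree\<^esub> k = on_bits (ev T (v @ u))"
      by (simp add: mult flip: on_bits_comp)
    then show ?case by blast
  qed
  moreover have "on_bits (ev T w) \<in> generate Aut_tree ?S" for w
  proof (induction w)
    case Nil
    have "on_bits (ev T []) = \<one>\<^bsub>Aut_tree\<^esub>" by (simp only: unit ev_Nil_id on_bits_id)
    then show ?case using generate.one by metis
  next
    case (Cons l w)
    obtain s i where l: "l = (s, i)" by fastforce
    have "on_bits (ev T [l]) \<in> generate Aut_tree ?S"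
      using generate.incl[OF gen[of s], of Aut_tree] generate.inv[OF gen[of s], of Aut_tree]
      by (cases i) (simp_all add: l inv state[symmetric])
    then have "on_bits (ev T w) \<otimes>\<^bsub>Aut_tree\<^esub> on_bits (ev T [l]) \<in> generate Aut_tree ?S"
      by (rule generate.eng[OF Cons])
    then show ?case by (simp only: ev_Cons[of T l w] mult on_bits_comp)
  qed
  ultimately show ?thesis
    unfolding automaton_group_def carrier_subgroup_generated sub by blast
qed

lemma not_infinite_torsion:
  assumes "finite_or_non_torsion T"
  shows "\<not> (infinite (carrier (automaton_group A)) \<and> torsion_group (automaton_group A))"
proof
  assume inf: "infinite (carrier (automaton_group A)) \<and> torsion_group (automaton_group A)"
  then have "infinite (range (ev T))" by (auto simp: carrier_automaton_group)
  then obtain w where w: "\<And>n. \<not> exponent T w n"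
    using assms by (auto simp: finite_or_non_torsion_def)
  have "on_bits (ev T w) \<in> carrier (automaton_group A)"
    by (auto simp: carrier_automaton_group)
  with inf obtain n :: nat where n: "n > 0"
    "on_bits (ev T w) [^]\<^bsub>automaton_group A\<^esub> n = \<one>\<^bsub>automaton_group A\<^esub>"
    unfolding torsion_group_def by blast
  have "g [^]\<^bsub>automaton_group A\<^esub> m = g ^^ m" for g m
    by (induction m) (auto simp: automaton_group_def subgroup_generated_def Aut_tree_def funpow_swap1)
  with n have "on_bits (ev T w ^^ n) = on_bits id"
    by (simp add: on_bits_funpow on_bits_id automaton_group_def subgroup_generated_def Aut_tree_def)
  then have "exponent T w n" using n(1) unfolding exponent_def by (intro conjI on_bits_inject)
  then show False by (rule notE[OF w])
qed

end

text \<open>Applied to the activities, this is the renaming of states that leaves only nondecreasing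
  activity patterns.\<close>

lemma sorted_enumeration:
  fixes e :: "'q \<Rightarrow> nat"
  assumes "CARD('q) = 3"
  obtains f :: "st \<Rightarrow> 'q" where "bij f" "e (f S0) \<le> e (f S1)" "e (f S1) \<le> e (f S2)"
proof -
  have fin: "finite (UNIV :: 'q set)" using assms by (metis card.infinite zero_neq_numeral)
  obtain xs :: "'q list" where xs: "set xs = UNIV" "distinct xs"
    using finite_distinct_list[OF fin] by blast
  define ys where "ys = sort_key e xs"
  have ys: "set ys = UNIV" "distinct ys" "sorted (map e ys)" "length ys = 3"
    using xs assms distinct_card[of xs] by (auto simp: ys_def)
  then obtain a b c where abc: "ys = [a, b, c]"
    by (auto simp: numeral_3_eq_3 length_Suc_conv)
  define f where "f s = (case s of S0 \<Rightarrow> a | S1 \<Rightarrow> b | S2 \<Rightarrow> c)" for s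
  have "inj f" using ys(2) by (auto simp: inj_def f_def abc split: st.splits)
  moreover have "range f = UNIV"
  proof -
    have "{f S0, f S1, f S2} \<subseteq> range f" by blast
    then show ?thesis using ys(1) by (auto simp: f_def abc)
  qed
  ultimately show ?thesis using that[of f] ys(3) by (auto simp: bij_def f_def abc)
qed

theorem theorem5:
  fixes A :: "'q automaton"
  assumes "CARD('q) = 3"
    and "invertible_automaton A"
  shows "\<not> (infinite (carrier (automaton_group A)) \<and> torsion_group (automaton_group A))"
proof -
  obtain f :: "st \<Rightarrow> 'q" where f: "bij f" "expo A (f S0) \<le> expo A (f S1)" "expo A (f S1) \<le> expo A (f S2)"
    using sorted_enumeration[OF assms(1)] by blast
  define r where "r s = (inv_into UNIV f (succ A (f s) 0), inv_into UNIV f (succ A (f s) 1))" for s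
  define T :: table where "T = ((expo A (f S0) = 1, expo A (f S1) = 1, expo A (f S2) = 1), r S0, r S1, r S2)"
  have "row T s = r s" for s by (cases s) (auto simp: T_def)
  then have nxt: "f (nxt T s (x = 1)) = succ A (f s) x" for s x
    using f(1) by (cases x) (auto simp: nxt_def r_def bij_is_surj surj_f_inv_f)
  have expo: "expo A q = of_bool (expo A q = 1)" for q
    using assms(2) by (auto simp: invertible_automaton_def)
  have act: "act T s = (expo A (f s) = 1)" for s by (cases s) (auto simp: T_def)
  have "expo A q \<le> 1" for q
    using expo[of q] by (metis of_bool_less_eq_one)
  then have "act T S0 \<le> act T S1" "act T S1 \<le> act T S2"
    using f(2,3) by (auto simp: act le_bool_def intro: antisym)
  from finite_or_non_torsion_sorted[OF this] have T: "finite_or_non_torsion T" .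
  have "expo A (f s) = of_bool (act T s)" for s using expo[of "f s"] by (simp only: act)
  with T nxt bij_is_surj[OF f(1)] show ?thesis by (intro not_infinite_torsion[of f T A])
qed

end
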